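(* For every $n\ge1$, the map $F_{\mathrm{alt}}$ defined in the context induces a bijection $F_{\mathrm{alt}}:\mathrm{Alt}^{-1}_{2n+1}\to \mathrm{Alt}^{-1}_{2n+1}$. Moreover, if $\pi\in \mathrm{Alt}^{-1}_{2n+1}$ and $\sigma=F_{\mathrm{alt}}(\pi)$, then \[ \mathrm{maj}(\kappa_{2n+1} \pi) = \mathrm{inv}(\sigma)-\mathrm{ndes}((\sigma^{-1})_e). \]
   Context: Permutations of $\{1,\dots,m\}$ are also written as words $\pi_1\cdots\pi_m$, $\pi_i=\pi(i)$; products are compositions, $\pi\sigma(i)=\pi(\sigma(i))$. $\mathrm{Alt}_m$ is the set of permutations with $\pi_1<\pi_2>\pi_3<\cdots$, and $\mathrm{Alt}^{-1}_m=\{\pi:\pi^{-1}\in\mathrm{Alt}_m\}$. $\kappa_{2n+1}=(1)(2,3)(4,5)\cdots(2n,2n+1)$ in cycle notation. For a permutation $\tau$, $\tau_e=\tau_2\tau_4\tau_6\cdots$ is the word of entries in even positions. For a word $w=w_1\cdots w_m$: $\mathrm{maj}(w)$ is the sum of all $i\in\{1,\dots,m-1\}$ with $w_i>w_{i+1}$; $\mathrm{inv}(w)$ is the number of pairs $i<j$ with $w_i>w_j$; $\mathrm{ndes}(w)=m-\#\{i\in\{1,\dots,m-1\}:w_i>w_{i+1}\}$. Definition of $f$. Let $\prec$ be a total order on $\mathbb N$ and $w_1\cdots w_k$ ($k\ge2$) a word of distinct positive integers. Let $0=b_0<b_1<\dots<b_m=k-1$ be the integers such that: if $w_{k-1}\prec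 w_k$, then $\{b_1,\dots,b_m\}$ is the set of $j\in\{1,\dots,k-1\}$ with $w_j\prec w_k$; if $w_k\prec w_{k-1}$, then $\{b_1,\dots,b_m\}$ is the set of $j\in\{1,\dots,k-1\}$ with $w_k\prec w_j$. For $1\le j\le m$ let $B_j=w_{b_{j-1}+1}\cdots w_{b_j}$ and let $B_j'=w_{b_j}w_{b_{j-1}+1}\cdots w_{b_j-1}$ (move the last letter of $B_j$ to the front). Then $f(w_1\cdots w_k,\prec)=B_1'B_2'\cdots B_m'w_k$. For $i\ge1$, $<_i$ is the total order on $\mathbb N$ obtained from the natural order $<$ by reversing the order of $i$ and $i+1$ only: for $a<b$ with $(a,b)\ne(i,i+1)$ we have $a<_ib$, and $i+1<_ii$. Definition of $F_{\mathrm{alt}}$. For $\pi\in\mathrm{Alt}^{-1}_{2n+1}$ set $w^{(1)}=\pi_1$. For $2\le k\le 2n+1$: if $\pi_k=2i$ for some $i$ and $2i+2$ does not occur among $\pi_1,\dots,\pi_{k-1}$, then $w^{(k)}=f(w^{(k-1)}\pi_k,<_{2i})$; otherwise $w^{(k)}=f(w^{(k-1)}\pi_k,<)$. Here $w^{(k-1)}\pi_k$ is concatenation. Then $F_{\mathrm{alt}}(\pi)=w^{(2n+1)}$. *)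

theory Defs
  imports "HOL-Combinatorics.Permutations"
begin

text \<open>
  A permutation of \<open>{1..m}\<close> is a function \<open>p\<close> with \<open>p permutes {1..m}\<close>; a word is a list of
  naturals. Letters of words are numbered from 1. \<open>perm_of\<close> extends a word by the identity outside
  \<open>{1..m}\<close>, so that a permutation word yields a function in the sense of \<open>permutes\<close>.
\<close>

definition letter :: "nat list \<Rightarrow> nat \<Rightarrow> nat" where
  "letter w i = w ! (i - 1)"

definition word_of :: "nat \<Rightarrow> (nat \<Rightarrow> nat) \<Rightarrow> nat list" where
  "word_of m p = map p [1..<m + 1]"

definition perm_of :: "nat list \<Rightarrow> nat \<Rightarrow> nat" where
  "perm_of w i = (if i \<in> {1..length w} then letter w i else i)"

definition Alt :: "nat \<Rightarrow> (nat \<Rightarrow> nat) set" where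
  "Alt m = {p. p permutes {1..m} \<and>
     (\<forall>i\<in>{1..<m}. if odd i then p i < p (i + 1) else p i > p (i + 1))}"

definition Alt_inv :: "nat \<Rightarrow> (nat \<Rightarrow> nat) set" where
  "Alt_inv m = {p. p permutes {1..m} \<and> inv p \<in> Alt m}"

text \<open>The involution \<open>(1)(2,3)(4,5)\<dots>(2n,2n+1)\<close>.\<close>

definition kappa :: "nat \<Rightarrow> nat \<Rightarrow> nat" where
  "kappa n i = (if i \<in> {2..2 * n + 1} then (if even i then i + 1 else i - 1) else i)"

definition even_part :: "nat list \<Rightarrow> nat list" where
  "even_part w = map (letter w) (filter even [1..<length w + 1])"

definition descents :: "nat list \<Rightarrow> nat set" where
  "descents w = {i \<in> {1..<length w}. letter w i > letter w (i + 1)}"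

definition maj :: "nat list \<Rightarrow> nat" where
  "maj w = \<Sum> (descents w)"

definition inversions :: "nat list \<Rightarrow> nat" where
  "inversions w =
     card {(i, j) \<in> {1..length w} \<times> {1..length w}. i < j \<and> letter w i > letter w j}"

definition ndes :: "nat list \<Rightarrow> nat" where
  "ndes w = length w - card (descents w)"

text \<open>
  \<open>cuts w prec\<close> is the set \<open>{b\<^sub>1, \<dots>, b\<^sub>m}\<close> and \<open>cut w prec j\<close> is \<open>b\<^sub>j\<close>, with \<open>b\<^sub>0 = 0\<close>.
  For a strict total order \<open>prec\<close> and distinct letters, the else-branch is the case
  \<open>w\<^sub>k \<prec> w\<^sub>k\<^sub>-\<^sub>1\<close>.
\<close>

definition cuts :: "nat list \<Rightarrow> (nat \<Rightarrow> nat \<Rightarrow> bool) \<Rightarrow> nat set" where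
  "cuts w prec = (let k = length w in
     if prec (letter w (k - 1)) (letter w k)
     then {j \<in> {1..k - 1}. prec (letter w j) (letter w k)}
     else {j \<in> {1..k - 1}. prec (letter w k) (letter w j)})"

definition cut :: "nat list \<Rightarrow> (nat \<Rightarrow> nat \<Rightarrow> bool) \<Rightarrow> nat \<Rightarrow> nat" where
  "cut w prec j = (0 # sorted_list_of_set (cuts w prec)) ! j"

definition block :: "nat list \<Rightarrow> (nat \<Rightarrow> nat \<Rightarrow> bool) \<Rightarrow> nat \<Rightarrow> nat list" where
  "block w prec j = map (letter w) [cut w prec (j - 1) + 1..<cut w prec j + 1]"

definition last_to_front :: "nat list \<Rightarrow> nat list" where
  "last_to_front u = last u # butlast u"

definition f_word :: "nat list \<Rightarrow> (nat \<Rightarrow> nat \<Rightarrow> bool) \<Rightarrow> nat list" where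
  "f_word w prec =
     concat (map (\<lambda>j. last_to_front (block w prec j)) [1..<card (cuts w prec) + 1])
       @ [letter w (length w)]"

definition less_swap :: "nat \<Rightarrow> nat \<Rightarrow> nat \<Rightarrow> bool" where
  "less_swap i a b \<longleftrightarrow> (a < b \<and> (a, b) \<noteq> (i, i + 1)) \<or> (a = i + 1 \<and> b = i)"

text \<open>The order used when the letter \<open>\<pi>\<^sub>k\<close> is appended; if \<open>\<pi>\<^sub>k = 2i\<close> then \<open>2i + 2 = \<pi>\<^sub>k + 2\<close>.\<close>

definition step_order :: "(nat \<Rightarrow> nat) \<Rightarrow> nat \<Rightarrow> nat \<Rightarrow> nat \<Rightarrow> bool" where
  "step_order p k =
     (if even (p k) \<and> p k + 2 \<notin> p ` {1..k - 1} then less_swap (p k) else (<))"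

text \<open>\<open>alt_word p k\<close> is \<open>w\<^sup>(\<^sup>k\<^sup>)\<close>; the value at \<open>k = 0\<close> is a dummy.\<close>

fun alt_word :: "(nat \<Rightarrow> nat) \<Rightarrow> nat \<Rightarrow> nat list" where
  "alt_word p 0 = []"
| "alt_word p (Suc 0) = [p 1]"
| "alt_word p (Suc (Suc k)) =
     f_word (alt_word p (Suc k) @ [p (Suc (Suc k))]) (step_order p (Suc (Suc k)))"

definition F_alt :: "nat \<Rightarrow> (nat \<Rightarrow> nat) \<Rightarrow> nat \<Rightarrow> nat" where
  "F_alt n p = perm_of (alt_word p (2 * n + 1))"

end

theory Submission
  imports Defs
begin

text \<open>
  Appending a letter \<open>x\<close> to a word \<open>u\<close> and applying \<open>f\<close> cuts \<open>u\<close> after every letter that lies on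
  the same side of \<open>x\<close> as the last letter of \<open>u\<close>, and moves the last letter of each block to the front
  of its block. Such a block rotation has three properties.

  First, it changes the number of inversions by exactly the number of letters on the other side of
  \<open>x\<close>, downwards if the last letter is \<open>\<prec> x\<close> and upwards if it is \<open>\<succ> x\<close>. Adding the inversions
  formed with \<open>x\<close> itself, the inversion number grows by \<open>0\<close> in the first case and by \<open>|u|\<close> in the
  second, as in Foata's bijection, provided that \<open>\<prec>\<close> and \<open><\<close> agree around \<open>x\<close>. When \<open>x = 2i\<close> and the
  order is \<open><\<^sub>2\<^sub>i\<close>, they disagree at the single letter \<open>2i+1\<close>, which already occurs in \<open>u\<close> because
  \<open>\<pi>\<close> is the inverse of an alternating permutation; this costs one more inversion
  (\<open>alt_word_inv_count_step\<close>). Summing over all steps gives two terms. The sum of the growths \<open>|u|\<close> is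
  \<open>maj(\<kappa>\<pi>)\<close>, since the descents of \<open>\<kappa>\<pi>\<close> are exactly the steps of the second case
  (\<open>kappa_descent_iff\<close>). The number of steps with a modified order counts the \<open>i\<close> for which \<open>2i+2\<close> does
  not occur before \<open>2i\<close>, which is \<open>ndes((\<pi>\<^sup>-\<^sup>1)\<^sub>e)\<close> (\<open>card_swapped_steps\<close>).

  Second, it keeps the relative order of any two letters on the same side of \<open>x\<close>. The orders are
  chosen such that the pairs \<open>{2i-1, 2i}\<close>, \<open>{2i, 2i+1}\<close> and \<open>{2i, 2i+2}\<close> are never separated by the new
  letter (\<open>adapted_order_linked\<close>). The first two kinds of pairs decide membership in \<open>Alt\<^sup>-\<^sup>1\<close>, so the map
  stays in this set; the third kind decides \<open>ndes((\<pi>\<^sup>-\<^sup>1)\<^sub>e)\<close>, so this number is the same for \<open>\<sigma>\<close>.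

  Third, it is injective: the first letter of the result tells the side, and the letters on that side
  mark the beginnings of the rotated blocks (\<open>side_rotates_unique\<close>). The order used at step \<open>k\<close> depends
  only on \<open>\<pi>\<^sub>k\<close> and the set of the earlier letters, hence only on \<open>w\<^sup>(\<^sup>k\<^sup>)\<close>, so all steps can be undone.
  An injective map of a finite set into itself is a bijection.
\<close>

section \<open>Block rotation\<close>

text \<open>
  The relation describes \<open>f\<close> without indices: a block is a maximal run of letters outside \<open>P\<close>
  followed by one letter in \<open>P\<close>, and a word is related to its rotation only if it ends with a
  complete block. Facts about \<open>f\<close> then follow by rule induction, one block at a time.
\<close>

inductive rotates :: "('a \<Rightarrow> bool) \<Rightarrow> 'a list \<Rightarrow> 'a list \<Rightarrow> bool" for P where
  rotates_Nil: "rotates P [] []"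
| rotates_block: "\<lbrakk>\<forall>v\<in>set vs. \<not> P v; P y; rotates P u v\<rbrakk>
    \<Longrightarrow> rotates P (vs @ y # u) (y # vs @ v)"

lemma rotates_mset: "rotates P u v \<Longrightarrow> mset v = mset u"
  by (induction rule: rotates.induct) auto

lemma rotates_hd: "rotates P u v \<Longrightarrow> v \<noteq> [] \<Longrightarrow> P (hd v)"
  by (erule rotates.cases) auto

text \<open>
  In a rotated word the letters in \<open>P\<close> are the first letters of the blocks, so the blocks can be
  read off from the rotated word.
\<close>

lemma rotates_right_unique:
  assumes "rotates P u v" "rotates P u' v"
  shows "u = u'"
  using assms
proof (induction arbitrary: u' rule: rotates.induct)
  case rotates_Nil
  then show ?case by (auto elim: rotates.cases)
next
  case (rotates_block vs y u v)
  from rotates_block.prems obtain vs' u1 v1 where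
    eq: "u' = vs' @ y # u1" "vs @ v = vs' @ v1" and np: "\<forall>a\<in>set vs'. \<not> P a" and r: "rotates P u1 v1"
    by (cases rule: rotates.cases) auto
  have tw: "takeWhile (\<lambda>a. \<not> P a) (xs @ ys) = xs"
    if "\<forall>a\<in>set xs. \<not> P a" "ys \<noteq> [] \<Longrightarrow> P (hd ys)" for xs ys
    using that by (cases ys) (auto simp: takeWhile_append)
  have "vs = vs'"
    using tw[of vs v] tw[of vs' v1] eq(2) np r rotates_block.hyps rotates_hd by metis
  with eq r rotates_block.IH show ?case by auto
qed

text \<open>
  This is the body of \<^const>\<open>f_word\<close>, with the cut positions as a parameter. The word may be longer than
  the last cut; the remaining letters are dropped.
\<close>

definition rotate_at :: "nat list \<Rightarrow> nat list \<Rightarrow> nat list" where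
  "rotate_at w cs = concat (map
     (\<lambda>j. last_to_front (map (letter w) [(0 # cs) ! (j - 1) + 1..<(0 # cs) ! j + 1]))
     [1..<length cs + 1])"

text \<open>Splitting off the first block shifts all later cut positions by its length.\<close>

lemma rotate_at_Cons:
  assumes "c \<le> length w"
  shows "rotate_at w (c # map ((+) c) cs) = last_to_front (take c w) @ rotate_at (drop c w) cs"
proof -
  have first: "map (letter w) [1..<c + 1] = take c w"
    using assms by (intro nth_equalityI) (auto simp: letter_def simp del: upt_Suc)
  have upt: "[1..<length (c # map ((+) c) cs) + 1] = 1 # map Suc [1..<length cs + 1]"
    by (simp add: map_Suc_upt upt_conv_Cons[of "Suc 0"] del: upt_Suc)
  have rest: "map (letter w)
        [(0 # c # map ((+) c) cs) ! (Suc j - 1) + 1..<(0 # c # map ((+) c) cs) ! (Suc j) + 1]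
      = map (letter (drop c w)) [(0 # cs) ! (j - 1) + 1..<(0 # cs) ! j + 1]"
    if j_in: "j \<in> set [1..<length cs + 1]" for j
  proof -
    have cut: "(0 # c # map ((+) c) cs) ! Suc i = c + (0 # cs) ! i" if "i \<le> length cs" for i
      using that by (cases i) auto
    obtain i where i: "j = Suc i" "i < length cs"
      using j_in by - (cases j, auto simp del: upt_Suc)
    have "(0 # c # map ((+) c) cs) ! (Suc j - 1) = c + (0 # cs) ! (j - 1)"
      "(0 # c # map ((+) c) cs) ! Suc j = c + (0 # cs) ! j"
      using cut[of i] cut[of "Suc i"] i by (simp_all only: diff_Suc_1 Suc_leI less_imp_le_nat)
    then show ?thesis
      using assms by (intro nth_equalityI) (auto simp: letter_def add.assoc simp del: upt_Suc nth_Cons_Suc)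
  qed
  have tail: "map (\<lambda>j. last_to_front (map (letter w)
        [(0 # c # map ((+) c) cs) ! (Suc j - 1) + 1..<(0 # c # map ((+) c) cs) ! (Suc j) + 1]))
        [1..<length cs + 1]
      = map (\<lambda>j. last_to_front (map (letter (drop c w))
          [(0 # cs) ! (j - 1) + 1..<(0 # cs) ! j + 1])) [1..<length cs + 1]"
    by (intro map_cong refl arg_cong[where f = last_to_front] rest)
  show ?thesis
    unfolding rotate_at_def upt list.map concat.simps map_map o_def tail
    using first by (simp del: upt_Suc)
qed

definition positions :: "('a \<Rightarrow> bool) \<Rightarrow> 'a list \<Rightarrow> nat list" where
  "positions P u = filter (\<lambda>j. P (u ! (j - 1))) [1..<length u + 1]"

lemma positions_block:
  assumes "\<forall>v\<in>set vs. \<not> P v" "P y"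
  shows "positions P (vs @ y # u) = Suc (length vs) # map ((+) (Suc (length vs))) (positions P u)"
proof -
  let ?c = "Suc (length vs)"
  have "[1..<length (vs @ y # u) + 1] = [1..<?c] @ ?c # map ((+) ?c) [1..<length u + 1]"
  proof -
    have "map ((+) ?c) [1..<length u + 1] = [Suc ?c..<?c + length u + 1]"
      by (intro nth_equalityI) (auto simp del: upt_Suc)
    moreover have "[1..<?c + length u + 1] = [1..<?c] @ [?c..<?c + length u + 1]"
      using upt_add_eq_append[of 1 ?c "length u + 1"] by (simp del: upt_Suc)
    ultimately show ?thesis
      by (simp add: upt_conv_Cons del: upt_Suc)
  qed
  moreover have "filter (\<lambda>j. P ((vs @ y # u) ! (j - 1))) [1..<?c] = []"
    using assms by (auto simp: filter_empty_conv nth_append)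
  moreover have "filter (\<lambda>j. P ((vs @ y # u) ! (j - 1))) (map ((+) ?c) [1..<length u + 1])
      = map ((+) ?c) (positions P u)"
    unfolding positions_def filter_map o_def
    by (rule arg_cong[where f = "map _"], rule filter_cong)
       (auto simp: nth_append nth_Cons' simp del: upt_Suc)
  ultimately show ?thesis
    using assms(2) unfolding positions_def by (simp del: upt_Suc)
qed

lemma rotates_rotate_at:
  assumes "u = [] \<or> P (last u)"
  shows "rotates P u (rotate_at (u @ t) (positions P u))"
  using assms
proof (induction u rule: length_induct)
  case (1 u)
  show ?case
  proof (cases "u = []")
    case True
    then show ?thesis by (simp add: rotate_at_def positions_def rotates_Nil)
  next
    case False
    with 1 have "\<exists>a\<in>set u. P a" by (meson last_in_set)
    then obtain vs y u' where u: "u = vs @ y # u'" "P y" "\<forall>v\<in>set vs. \<not> P v"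
      by (rule split_list_first_propE)
    have "rotates P u' (rotate_at (u' @ t) (positions P u'))"
    proof (rule "1.IH"[rule_format])
      show "length u' < length u" using u by simp
      show "u' = [] \<or> P (last u')" using "1.prems" u by (cases "u' = []") auto
    qed
    then show ?thesis
      using u by (simp add: positions_block rotate_at_Cons last_to_front_def butlast_append
          rotates_block)
  qed
qed

text \<open>The letters on the same side of \<open>x\<close> as \<open>l\<close>, for a letter \<open>l\<close> comparable with \<open>x\<close>.\<close>

definition side :: "(nat \<Rightarrow> nat \<Rightarrow> bool) \<Rightarrow> nat \<Rightarrow> nat \<Rightarrow> nat \<Rightarrow> bool" where
  "side prec l x = (if prec l x then (\<lambda>a. prec a x) else prec x)"

text \<open>
  The hypothesis that \<open>x\<close> is comparable with the last letter of \<open>u\<close> makes the last letter of \<open>u\<close> end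
  a block, so that no letter of \<open>u\<close> is lost.
\<close>

lemma f_word_rotates:
  assumes "u \<noteq> []" "prec (last u) x \<or> prec x (last u)"
  obtains v where "f_word (u @ [x]) prec = v @ [x]" "rotates (side prec (last u) x) u v"
proof -
  let ?P = "side prec (last u) x"
  have last: "letter (u @ [x]) (length u) = last u" "letter (u @ [x]) (Suc (length u)) = x"
    using assms(1) by (auto simp: letter_def nth_append last_conv_nth)
  have "cuts (u @ [x]) prec = {j \<in> {1..length u}. ?P (letter (u @ [x]) j)}"
    by (simp add: cuts_def last side_def)
  also have "\<dots> = set (positions ?P u)"
    by (auto simp: positions_def letter_def nth_append)
  finally have cuts: "cuts (u @ [x]) prec = set (positions ?P u)" .
  have "sorted_list_of_set (set (positions ?P u)) = positions ?P u"
    by (rule sorted_list_of_set.idem_if_sorted_distinct)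
       (auto simp: positions_def sorted_wrt_filter simp del: upt_Suc)
  moreover have "card (set (positions ?P u)) = length (positions ?P u)"
    by (rule distinct_card) (simp add: positions_def)
  ultimately have "f_word (u @ [x]) prec = rotate_at (u @ [x]) (positions ?P u) @ [x]"
    by (simp add: f_word_def rotate_at_def cuts block_def cut_def last del: upt_Suc)
  moreover have "rotates ?P u (rotate_at (u @ [x]) (positions ?P u))"
    using assms by (intro rotates_rotate_at) (auto simp: side_def)
  ultimately show ?thesis using that by blast
qed

section \<open>Inversions\<close>

fun inv_count :: "nat list \<Rightarrow> nat" where
  "inv_count [] = 0"
| "inv_count (x # xs) = length (filter (\<lambda>y. y < x) xs) + inv_count xs"

lemma inversions_eq_inv_count: "inversions w = inv_count w"
proof (induction w)
  case Nil
  then show ?case by (simp add: inversions_def)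
next
  case (Cons x xs)
  let ?I = "\<lambda>w. {(i, j) \<in> {1..length w} \<times> {1..length w}. i < j \<and> letter w i > letter w j}"
  let ?A = "(\<lambda>j. (1 :: nat, j + 2)) ` {j. j < length xs \<and> xs ! j < x}"
  let ?B = "(\<lambda>(i, j). (i + 1, j + 1)) ` ?I xs"
  (* ?A collects the inversions that involve the first letter, ?B the others. *)
  have "?I (x # xs) = ?A \<union> ?B"
  proof (intro equalityI subsetI)
    fix q assume q: "q \<in> ?I (x # xs)"
    then obtain i j where ij: "q = (i, j)" "1 \<le> i" "i < j" "j \<le> Suc (length xs)"
      "letter (x # xs) i > letter (x # xs) j" by auto
    show "q \<in> ?A \<union> ?B"
    proof (cases "i = 1")
      case True
      with ij have "q = (1, (j - 2) + 2)" "j - 2 < length xs" "xs ! (j - 2) < x"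
        by (auto simp: letter_def nth_Cons' numeral_2_eq_2)
      then show ?thesis by blast
    next
      case False
      with ij have "(i - 1, j - 1) \<in> ?I xs" "q = (\<lambda>(i, j). (i + 1, j + 1)) (i - 1, j - 1)"
        by (auto simp: letter_def nth_Cons')
      then show ?thesis by blast
    qed
  qed (auto simp: letter_def nth_Cons')
  moreover have "card (?A \<union> ?B) = card ?A + card ?B"
  proof (rule card_Un_disjoint)
    have "finite (?I xs)"
      by (rule finite_subset[of _ "{1..length xs} \<times> {1..length xs}"]) auto
    then show "finite ?B" by (rule finite_imageI)
  qed auto
  moreover have "card ?A = length (filter (\<lambda>y. y < x) xs)"
    by (subst card_image) (auto simp: inj_on_def length_filter_conv_card)
  moreover have "card ?B = card (?I xs)"
    by (rule card_image) (auto simp: inj_on_def)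
  ultimately show ?case
    using Cons unfolding inversions_def inv_count.simps by (simp only:)
qed

lemma inv_count_append:
  "inv_count (xs @ ys) = inv_count xs + inv_count ys + (\<Sum>x\<leftarrow>xs. length (filter (\<lambda>y. y < x) ys))"
  by (induction xs) auto

lemma inv_count_snoc:
  "inv_count (xs @ [x]) = inv_count xs + length (filter (\<lambda>y. x < y) xs)"
  by (induction xs) auto

lemma length_filter_mset: "mset u = mset v \<Longrightarrow> length (filter Q u) = length (filter Q v)"
  by (metis mset_filter size_mset)

text \<open>
  Rotating a block moves its last letter, which is in \<open>P\<close>, across all other letters of the block,
  which are not. If the letters in \<open>P\<close> are the small ones, each crossing removes an inversion; every
  letter outside \<open>P\<close> is crossed exactly once. Inversions between different blocks depend only on the
  contents of the blocks and do not change.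
\<close>

lemma inv_count_rotates_small:
  assumes "rotates P u v" "\<And>a b. a \<in> set u \<Longrightarrow> b \<in> set u \<Longrightarrow> \<not> P a \<Longrightarrow> P b \<Longrightarrow> b < a"
  shows "inv_count u = inv_count v + length (filter (\<lambda>a. \<not> P a) u)"
  using assms
proof (induction rule: rotates.induct)
  case (rotates_block vs y u v)
  have m: "mset v = mset u" by (rule rotates_mset) (fact rotates_block.hyps)
  have sep: "y < b" if "b \<in> set vs" for b
    using rotates_block.prems[of b y] rotates_block.hyps that by auto
  have "filter (\<lambda>b. y < b) vs = vs" "filter (\<lambda>b. b < y) vs = []" "filter (\<lambda>a. \<not> P a) vs = vs"
    using rotates_block.hyps(1) by (auto simp: filter_id_conv filter_empty_conv dest: sep)
  moreover have "inv_count (vs @ y # u) = inv_count vs + length (filter (\<lambda>b. y < b) vs) + inv_count u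
      + (\<Sum>x\<leftarrow>vs. length (filter (\<lambda>b. b < x) u)) + length (filter (\<lambda>b. b < y) u)"
    using inv_count_append[of "vs @ [y]" u] by (simp add: inv_count_snoc)
  moreover have "inv_count (y # vs @ v) = inv_count vs + length (filter (\<lambda>b. b < y) vs) + inv_count v
      + (\<Sum>x\<leftarrow>vs. length (filter (\<lambda>b. b < x) u)) + length (filter (\<lambda>b. b < y) u)"
    by (simp add: inv_count_append length_filter_mset[OF m])
  moreover have "inv_count u = inv_count v + length (filter (\<lambda>a. \<not> P a) u)"
    using rotates_block by simp
  ultimately show ?case
    using rotates_block.hyps(2) by simp
qed simp

text \<open>If the letters in \<open>P\<close> are the large ones, each crossing creates an inversion.\<close>

lemma inv_count_rotates_large:
  assumes "rotates P u v" "\<And>a b. a \<in> set u \<Longrightarrow> b \<in> set u \<Longrightarrow> \<not> P a \<Longrightarrow> P b \<Longrightarrow> a < b"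
  shows "inv_count v = inv_count u + length (filter (\<lambda>a. \<not> P a) u)"
  using assms
proof (induction rule: rotates.induct)
  case (rotates_block vs y u v)
  have m: "mset v = mset u" by (rule rotates_mset) (fact rotates_block.hyps)
  have sep: "b < y" if "b \<in> set vs" for b
    using rotates_block.prems[of b y] rotates_block.hyps that by auto
  have "filter (\<lambda>b. y < b) vs = []" "filter (\<lambda>b. b < y) vs = vs" "filter (\<lambda>a. \<not> P a) vs = vs"
    using rotates_block.hyps(1) by (auto simp: filter_id_conv filter_empty_conv dest: sep)
  moreover have "inv_count (vs @ y # u) = inv_count vs + length (filter (\<lambda>b. y < b) vs) + inv_count u
      + (\<Sum>x\<leftarrow>vs. length (filter (\<lambda>b. b < x) u)) + length (filter (\<lambda>b. b < y) u)"
    using inv_count_append[of "vs @ [y]" u] by (simp add: inv_count_snoc)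
  moreover have "inv_count (y # vs @ v) = inv_count vs + length (filter (\<lambda>b. b < y) vs) + inv_count v
      + (\<Sum>x\<leftarrow>vs. length (filter (\<lambda>b. b < x) u)) + length (filter (\<lambda>b. b < y) u)"
    by (simp add: inv_count_append length_filter_mset[OF m])
  moreover have "inv_count v = inv_count u + length (filter (\<lambda>a. \<not> P a) u)"
    using rotates_block by simp
  ultimately show ?case
    using rotates_block.hyps(2) by simp
qed simp

section \<open>Relative order of letters\<close>

text \<open>
  For a word with distinct letters this compares positions, that is, values of the inverse
  permutation; unlike positions it behaves well under concatenation.
\<close>

fun precedes :: "'a list \<Rightarrow> 'a \<Rightarrow> 'a \<Rightarrow> bool" where
  "precedes [] a b = False"
| "precedes (x # xs) a b = ((x = a \<and> b \<in> set xs) \<or> precedes xs a b)"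

lemma precedes_append:
  "precedes (xs @ ys) a b \<longleftrightarrow> precedes xs a b \<or> precedes ys a b \<or> (a \<in> set xs \<and> b \<in> set ys)"
  by (induction xs) auto

lemma precedes_in_set: "precedes w a b \<Longrightarrow> a \<in> set w \<and> b \<in> set w"
  by (induction w) auto

text \<open>A crossing always involves one letter in \<open>P\<close> and one outside \<open>P\<close>.\<close>

lemma precedes_rotates:
  assumes "rotates P u v" "P a = P b"
  shows "precedes v a b = precedes u a b"
  using assms(1)
proof (induction rule: rotates.induct)
  case (rotates_block vs y u v)
  have "set v = set u"
    using rotates_mset[OF rotates_block.hyps(3)] by (metis set_mset_mset)
  with rotates_block assms(2) show ?case
    by (auto simp: precedes_append dest: precedes_in_set)
qed simp

lemma precedes_map_upt:
  "precedes (map p [1..<k + 1]) a b \<longleftrightarrow> (\<exists>i j. 1 \<le> i \<and> i < j \<and> j \<le> k \<and> p i = a \<and> p j = b)"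
proof (induction k)
  case (Suc k)
  have "map p [1..<Suc k + 1] = map p [1..<k + 1] @ [p (Suc k)]" by simp
  then have "precedes (map p [1..<Suc k + 1]) a b \<longleftrightarrow>
      precedes (map p [1..<k + 1]) a b \<or> (a \<in> set (map p [1..<k + 1]) \<and> b = p (Suc k))"
    by (simp only: precedes_append) auto
  also have "\<dots> \<longleftrightarrow> (\<exists>i j. 1 \<le> i \<and> i < j \<and> j \<le> Suc k \<and> p i = a \<and> p j = b)"
    unfolding Suc by (auto simp: le_Suc_eq less_Suc_eq_le simp del: upt_Suc) (metis le_imp_less_Suc)
  finally show ?case .
qed simp

lemma precedes_word_of_iff:
  assumes "p permutes {1..m}" "a \<in> {1..m}" "b \<in> {1..m}"
  shows "precedes (word_of m p) a b \<longleftrightarrow> inv p a < inv p b"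
proof -
  have "inv p permutes {1..m}" using assms(1) by (rule permutes_inv)
  then have "inv p a \<in> {1..m}" "inv p b \<in> {1..m}" using assms by (simp_all only: permutes_in_image)
  moreover have "p i = c \<longleftrightarrow> i = inv p c" for i c
    using assms(1) by (metis permutes_inverses)
  ultimately show ?thesis
    unfolding word_of_def precedes_map_upt by auto
qed


section \<open>The zigzag order\<close>

text \<open>
  The letters form the zigzag poset \<open>1 < 2 > 3 < 4 > \<dots>\<close>; the permutations in \<open>Alt\<^sup>-\<^sup>1\<close> are its linear
  extensions, and their prefixes are its order ideals.
\<close>

definition zigzag_ideal :: "nat set \<Rightarrow> bool" where
  "zigzag_ideal S \<longleftrightarrow> (\<forall>b\<in>S. even b \<longrightarrow> b - 1 \<in> S \<and> b + 1 \<in> S)"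

text \<open>
  The pairs whose relative order is tracked: the covering pairs of the zigzag poset, and the pairs of
  consecutive even letters. The orientation is the one in which the pairs are used later.
\<close>

definition linked :: "nat \<Rightarrow> nat \<Rightarrow> bool" where
  "linked a b \<longleftrightarrow> even b \<and> (a = b + 1 \<or> b = a + 1 \<or> a = b + 2)"

text \<open>
  The order of a step in terms of the set of earlier letters, which a word determines even if the
  permutation behind it is unknown.
\<close>

definition adapted_order :: "nat set \<Rightarrow> nat \<Rightarrow> nat \<Rightarrow> nat \<Rightarrow> bool" where
  "adapted_order S x = (if even x \<and> x + 2 \<notin> S then less_swap x else (<))"

lemma permutes_Suc_notin_image: "p permutes S \<Longrightarrow> p (Suc k) \<notin> p ` {1..k}"
  by (simp add: inj_image_mem_iff[OF permutes_inj])

lemma step_order_eq: "step_order p (Suc k) = adapted_order (p ` {1..k}) (p (Suc k))"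
  by (simp add: step_order_def adapted_order_def)

lemma adapted_order_total:
  "a \<noteq> x \<Longrightarrow> adapted_order S x x a \<longleftrightarrow> \<not> adapted_order S x a x"
  by (auto simp: adapted_order_def less_swap_def)

lemma adapted_order_iff:
  "adapted_order S x a x \<longleftrightarrow> a < x \<or> (a = x + 1 \<and> even x \<and> x + 2 \<notin> S)"
  by (auto simp: adapted_order_def less_swap_def)

text \<open>
  Under \<open><\<close>, only a pair \<open>{x-1, x+1}\<close> is separated by a letter \<open>x\<close> that is not in it. If it is linked, then
  \<open>x-1\<close> is even and was placed although its lower neighbour \<open>x\<close> was not, which an ideal excludes.
  Under the modified order, \<open>x+1\<close> moves below \<open>x\<close>. This keeps \<open>x+1\<close> together with \<open>x-1\<close>, and the newly separated
  linked pair \<open>{x+1, x+2}\<close> does not occur, since the order is modified only if \<open>x+2\<close> is absent.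
\<close>

lemma adapted_order_linked:
  assumes "zigzag_ideal S" "x \<notin> S" "a \<in> S" "b \<in> S" "linked a b"
  shows "adapted_order S x a x = adapted_order S x b x"
proof -
  have "a \<noteq> x" "b \<noteq> x" using assms by auto
  moreover have "b + 1 \<noteq> x" using assms by (auto simp: zigzag_ideal_def linked_def)
  moreover have "even b \<and> (a = b + 1 \<or> b = a + 1 \<or> a = b + 2)"
    using assms(5) by (simp add: linked_def)
  moreover note iff = adapted_order_iff[of S x]
  ultimately show ?thesis
  proof (cases "even x \<and> x + 2 \<notin> S")
    case True
    then have "a \<noteq> x + 2" "b \<noteq> x + 2" "even x" using assms by auto
    moreover have "adapted_order S x c x \<longleftrightarrow> c < x \<or> c = x + 1" for c
      using iff True by simp
    ultimately show ?thesis
      using \<open>even b \<and> _\<close> \<open>a \<noteq> x\<close> \<open>b \<noteq> x\<close> by presburger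
  next
    case False
    then have "adapted_order S x c x \<longleftrightarrow> c < x" for c
      using iff by blast
    then show ?thesis
      using \<open>even b \<and> _\<close> \<open>a \<noteq> x\<close> \<open>b \<noteq> x\<close> \<open>b + 1 \<noteq> x\<close> by presburger
  qed
qed

lemma Alt_inv_iff:
  "p \<in> Alt_inv m \<longleftrightarrow> p permutes {1..m} \<and>
     (\<forall>i\<in>{1..<m}. if odd i then precedes (word_of m p) i (i + 1)
        else precedes (word_of m p) (i + 1) i)"
proof (cases "p permutes {1..m}")
  case True
  have "precedes (word_of m p) i (i + 1) \<longleftrightarrow> inv p i < inv p (i + 1)"
    "precedes (word_of m p) (i + 1) i \<longleftrightarrow> inv p (i + 1) < inv p i" if "i \<in> {1..<m}" for i
    using that by (simp_all add: precedes_word_of_iff[OF True])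
  then show ?thesis
    unfolding Alt_inv_def Alt_def using True permutes_inv[OF True] by auto
qed (simp add: Alt_inv_def)

lemma Alt_inv_prefix_ideal:
  assumes "p \<in> Alt_inv (2 * n + 1)" "k \<le> 2 * n + 1"
  shows "zigzag_ideal (p ` {1..k})"
  unfolding zigzag_ideal_def
proof (intro ballI impI)
  let ?m = "2 * n + 1"
  have p: "p permutes {1..?m}" using assms(1) by (simp add: Alt_inv_def)
  fix b assume b: "b \<in> p ` {1..k}" "even b"
  (* An even letter is smaller than the odd number 2 * n + 1, so b + 1 is a letter, too. *)
  have "b \<in> {1..?m}" using b assms(2) permutes_image[OF p] by (auto simp: permutes_in_image[OF p])
  with b(2) have bm: "b - 1 \<in> {1..<?m}" "b \<in> {1..<?m}" "odd (b - 1)"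
    by (simp_all, presburger+)
  have below: "a \<in> p ` {1..k}" if before: "precedes (word_of ?m p) a b" for a
  proof -
    obtain i j where ij: "1 \<le> i" "i < j" "j \<le> ?m" "p i = a" "p j = b"
      using before unfolding word_of_def precedes_map_upt by blast
    moreover obtain j' where "j' \<le> k" "p j' = b" using b by auto
    moreover have "j = j'" using ij(5) \<open>p j' = b\<close> permutes_inj[OF p] by (metis injD)
    ultimately show ?thesis by auto
  qed
  have "precedes (word_of ?m p) (b - 1) (b - 1 + 1)" "precedes (word_of ?m p) (b + 1) b"
    using assms(1) bm b(2) unfolding Alt_inv_iff by (metis (full_types))+
  with below bm show "b - 1 \<in> p ` {1..k} \<and> b + 1 \<in> p ` {1..k}" by auto
qed

section \<open>The words built by the map\<close>

text \<open>
  The last letter of \<open>w\<^sup>(\<^sup>k\<^sup>)\<close> is \<open>\<pi>\<^sub>k\<close>, as \<open>f\<close> fixes the last letter. Since this is proved by induction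
  over the steps, the description of a step first takes it as a hypothesis.
\<close>

lemma alt_word_step_if_last:
  assumes p: "p permutes {1..m}" and k: "1 \<le> k" "k < m"
    and inv: "mset (alt_word p k) = mset (map p [1..<k + 1])" "last (alt_word p k) = p k"
  obtains v where "alt_word p (Suc k) = v @ [p (Suc k)]"
    "rotates (side (step_order p (Suc k)) (p k) (p (Suc k))) (alt_word p k) v"
proof -
  have "p k \<noteq> p (Suc k)" by (simp add: inj_eq[OF permutes_inj[OF p]])
  then have tot: "step_order p (Suc k) (p k) (p (Suc k)) \<or> step_order p (Suc k) (p (Suc k)) (p k)"
    unfolding step_order_eq by (metis adapted_order_total)
  have ne: "alt_word p k \<noteq> []" using mset_eq_length[OF inv(1)] k by auto
  have "alt_word p (Suc k) = f_word (alt_word p k @ [p (Suc k)]) (step_order p (Suc k))"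
    using k(1) by (cases k) auto
  then show ?thesis
    using f_word_rotates[OF ne, of "step_order p (Suc k)" "p (Suc k)"] tot that
    unfolding inv(2) by metis
qed

lemma alt_word_mset_last:
  assumes p: "p permutes {1..m}" and k: "1 \<le> k" "k \<le> m"
  shows "mset (alt_word p k) = mset (map p [1..<k + 1]) \<and> last (alt_word p k) = p k"
  using k
proof (induction k rule: dec_induct)
  case (step k)
  then obtain v where "alt_word p (Suc k) = v @ [p (Suc k)]"
    "rotates (side (step_order p (Suc k)) (p k) (p (Suc k))) (alt_word p k) v"
    by (metis Suc_leD Suc_le_lessD alt_word_step_if_last[OF p])
  moreover have "mset (alt_word p k) = mset (map p [1..<k + 1])" using step by simp
  ultimately show ?case by (auto dest: rotates_mset)
qed simp

lemma alt_word_set: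
  assumes "p permutes {1..m}" "1 \<le> k" "k \<le> m"
  shows "set (alt_word p k) = p ` {1..k}" "distinct (alt_word p k)" "length (alt_word p k) = k"
    "last (alt_word p k) = p k"
proof -
  have m: "mset (alt_word p k) = mset (map p [1..<k + 1])" "last (alt_word p k) = p k"
    using alt_word_mset_last[OF assms] by auto
  have "distinct (map p [1..<k + 1])"
    using permutes_inj[OF assms(1)] by (auto simp: distinct_map intro: inj_on_subset)
  with m(1) show "distinct (alt_word p k)" by (metis mset_eq_imp_distinct_iff)
  show "set (alt_word p k) = p ` {1..k}"
    using mset_eq_setD[OF m(1)] by (auto simp: atLeastLessThanSuc_atLeastAtMost simp del: upt_Suc)
  show "length (alt_word p k) = k" using mset_eq_length[OF m(1)] by simp
  show "last (alt_word p k) = p k" by (fact m(2))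
qed

lemma alt_word_step:
  assumes "p permutes {1..m}" "1 \<le> k" "k < m"
  obtains v where "alt_word p (Suc k) = v @ [p (Suc k)]"
    "rotates (side (step_order p (Suc k)) (p k) (p (Suc k))) (alt_word p k) v"
proof -
  have "mset (alt_word p k) = mset (map p [1..<k + 1])" "last (alt_word p k) = p k"
    using alt_word_mset_last[OF assms(1,2)] assms(3) by auto
  with assms show ?thesis
    by (rule alt_word_step_if_last) (rule that)
qed

text \<open>
  If both letters were placed earlier, they lie on the same side of the new letter and keep their
  order; otherwise the new letter is last before and after the step.
\<close>

lemma alt_word_precedes:
  assumes p: "p \<in> Alt_inv (2 * n + 1)" and ab: "linked a b" and k: "1 \<le> k" "k \<le> 2 * n + 1"
  shows "precedes (alt_word p k) a b \<longleftrightarrow> precedes (map p [1..<k + 1]) a b"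
  using k
proof (induction k rule: dec_induct)
  case (step k)
  have pp: "p permutes {1..2 * n + 1}" using p by (simp add: Alt_inv_def)
  let ?x = "p (Suc k)" let ?S = "p ` {1..k}"
  let ?P = "side (step_order p (Suc k)) (p k) ?x"
  obtain v where v: "alt_word p (Suc k) = v @ [?x]" "rotates ?P (alt_word p k) v"
    using alt_word_step[OF pp step.hyps(1)] step.prems by auto
  have set: "set (alt_word p k) = ?S" using alt_word_set(1)[OF pp] step by simp
  have sv: "set v = ?S" using rotates_mset[OF v(2)] set by (metis set_mset_mset)
  have "?x \<notin> ?S" by (rule permutes_Suc_notin_image[OF pp])
  have same: "precedes v a b = precedes (alt_word p k) a b"
  proof (cases "a \<in> ?S \<and> b \<in> ?S")
    case True
    have "zigzag_ideal ?S" using Alt_inv_prefix_ideal[OF p] step.prems by simp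
    then have "adapted_order ?S ?x a ?x = adapted_order ?S ?x b ?x"
      using adapted_order_linked \<open>?x \<notin> ?S\<close> True ab by blast
    moreover have "a \<noteq> ?x" "b \<noteq> ?x" using True \<open>?x \<notin> ?S\<close> by metis+
    ultimately have "?P a = ?P b"
      unfolding side_def step_order_eq by (auto simp: adapted_order_total)
    then show ?thesis using precedes_rotates[OF v(2)] by metis
  next
    case False
    then show ?thesis using set sv precedes_in_set by metis
  qed
  have "map p [1..<Suc k + 1] = map p [1..<k + 1] @ [?x]" by simp
  moreover have "set (map p [1..<k + 1]) = ?S"
    by (auto simp: atLeastLessThanSuc_atLeastAtMost simp del: upt_Suc)
  moreover have "precedes (alt_word p k) a b \<longleftrightarrow> precedes (map p [1..<k + 1]) a b"
    using step by auto
  ultimately show ?case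
    unfolding v(1) by (simp only: precedes_append same sv)
qed simp

text \<open>
  If \<open>\<pi>\<^sub>k \<prec> x\<close>, the rotation removes one inversion for every letter \<open>\<succ> x\<close>, and \<open>x\<close> restores them.
  If \<open>\<pi>\<^sub>k \<succ> x\<close>, the rotation adds one for every letter \<open>\<prec> x\<close>, and \<open>x\<close> adds one for every letter \<open>\<succ> x\<close>,
  which together are all \<open>k\<close> letters. In both cases a modified order contributes one more inversion, formed
  by the letter \<open>x+1\<close>, which is larger than \<open>x\<close> but \<open>\<prec> x\<close>.
\<close>

lemma alt_word_inv_count_step:
  assumes p: "p \<in> Alt_inv (2 * n + 1)" and k: "1 \<le> k" "k < 2 * n + 1"
  shows "inv_count (alt_word p (Suc k)) = inv_count (alt_word p k)
      + (if step_order p (Suc k) (p k) (p (Suc k)) then 0 else k)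
      + (if even (p (Suc k)) \<and> p (Suc k) + 2 \<notin> p ` {1..k} then 1 else 0)"
proof -
  have pp: "p permutes {1..2 * n + 1}" using p by (simp add: Alt_inv_def)
  define x where "x = p (Suc k)"
  define S where "S = p ` {1..k}"
  define u where "u = alt_word p k"
  define prec where "prec = adapted_order S x"
  define e :: nat where "e = (if even x \<and> x + 2 \<notin> S then 1 else 0)"
  have prec: "step_order p (Suc k) = prec" by (simp add: prec_def S_def x_def step_order_eq)
  obtain v where v: "alt_word p (Suc k) = v @ [x]" "rotates (side prec (p k) x) u v"
    using alt_word_step[OF pp k] unfolding prec u_def x_def .
  have u: "set u = S" "distinct u" "length u = k"
    using alt_word_set[OF pp k(1)] k by (auto simp: u_def S_def)
  have xS: "x \<notin> S" unfolding x_def S_def by (rule permutes_Suc_notin_image[OF pp])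
  have tot: "prec x a \<longleftrightarrow> \<not> prec a x" if "a \<in> S" for a
    using that xS adapted_order_total prec_def by metis
  have "x + 1 \<in> S" if "even x"
  proof -
    have "zigzag_ideal (p ` {1..Suc k})" using Alt_inv_prefix_ideal[OF p] k by simp
    moreover have "p ` {1..Suc k} = insert x S"
      by (simp add: S_def x_def atLeastAtMostSuc_conv)
    ultimately have "zigzag_ideal (insert x S)" by (simp only:)
    then show ?thesis using that unfolding zigzag_ideal_def by auto
  qed
  then have larger: "length (filter (\<lambda>a. x < a) u) = length (filter (prec x) u) + e"
  proof (cases "even x \<and> x + 2 \<notin> S")
    case True
    have "{a. x < a} \<inter> set u = insert (x + 1) ({a. prec x a} \<inter> set u)"
      using True \<open>even x \<Longrightarrow> x + 1 \<in> S\<close> u(1) by (auto simp: prec_def adapted_order_def less_swap_def)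
    moreover have "\<not> prec x (x + 1)" using True by (simp add: prec_def adapted_order_def less_swap_def)
    ultimately show ?thesis using u(2) True by (simp add: distinct_length_filter e_def)
  next
    case False
    then show ?thesis by (auto simp: prec_def adapted_order_def e_def)
  qed
  (* The orders differ only in comparisons with x itself, so two letters separated by x
     compare in the same way under both. *)
  have sep: "b < a" if "a \<in> S" "b \<in> S" "prec x a" "prec b x" for a b
    using that xS unfolding prec_def adapted_order_def less_swap_def by (auto split: if_splits)
  have snoc: "inv_count (v @ [x]) = inv_count v + length (filter (prec x) u) + e"
    using larger length_filter_mset[OF rotates_mset[OF v(2)]] by (simp add: inv_count_snoc)
  show ?thesis
  proof (cases "prec (p k) x")
    case True
    then have P: "side prec (p k) x = (\<lambda>a. prec a x)" by (simp add: side_def)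
    have "inv_count u = inv_count v + length (filter (\<lambda>a. \<not> prec a x) u)"
      using v(2) unfolding P by (rule inv_count_rotates_small) (use u tot sep in auto)
    moreover have "filter (\<lambda>a. \<not> prec a x) u = filter (prec x) u"
      using u tot by (auto intro: filter_cong)
    ultimately show ?thesis
      using True snoc by (simp add: prec v(1) u_def e_def x_def S_def)
  next
    case False
    then have P: "side prec (p k) x = prec x" by (simp add: side_def)
    have "inv_count v = inv_count u + length (filter (\<lambda>a. \<not> prec x a) u)"
      using v(2) unfolding P by (rule inv_count_rotates_large) (use u tot sep in auto)
    then have "inv_count (v @ [x]) = inv_count u + k + e"
      using snoc sum_length_filter_compl[of "prec x" u] u(3) by simp
    then show ?thesis
      using False by (simp add: prec v(1) u_def e_def x_def S_def)
  qed
qed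

lemma alt_word_inv_count:
  assumes p: "p \<in> Alt_inv (2 * n + 1)" and k: "1 \<le> k" "k \<le> 2 * n + 1"
  shows "inv_count (alt_word p k)
    = (\<Sum>i\<in>{1..<k}. if step_order p (Suc i) (p i) (p (Suc i)) then 0 else i)
      + card {i \<in> {1..<k}. even (p (Suc i)) \<and> p (Suc i) + 2 \<notin> p ` {1..i}}"
  using k
proof (induction k rule: dec_induct)
  case (step k)
  let ?Q = "\<lambda>i. even (p (Suc i)) \<and> p (Suc i) + 2 \<notin> p ` {1..i}"
  have "{i \<in> {1..<Suc k}. ?Q i} = {i \<in> {1..<k}. ?Q i} \<union> (if ?Q k then {k} else {})"
    using step.hyps by (auto simp: less_Suc_eq)
  then have "card {i \<in> {1..<Suc k}. ?Q i} = card {i \<in> {1..<k}. ?Q i} + (if ?Q k then 1 else 0)"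
    by (auto simp: card_insert_if)
  then show ?case
    using step alt_word_inv_count_step[OF p, of k] by simp
qed simp

text \<open>
  Comparing images under \<open>\<kappa>\<close> is comparing under \<open><\<close> with each pair \<open>{2i, 2i+1}\<close> reversed. As \<open>2i+1\<close>
  occurs before \<open>2i\<close>, the two sides can differ only at adjacent letters \<open>2i+1, 2i\<close>, and only if the order
  is not modified there, that is, if \<open>2i+2\<close> occurs before them. But \<open>2i+2\<close> occurs after \<open>2i+1\<close>.
\<close>

lemma kappa_descent_iff:
  assumes p: "p \<in> Alt_inv (2 * n + 1)" and i: "i \<in> {1..<2 * n + 1}"
  shows "kappa n (p i) > kappa n (p (Suc i)) \<longleftrightarrow> \<not> step_order p (Suc i) (p i) (p (Suc i))"
proof -
  have pp: "p permutes {1..2 * n + 1}" using p by (simp add: Alt_inv_def)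
  let ?S = "p ` {1..i}" let ?x = "p (Suc i)"
  have in_m: "p i \<in> {1..2 * n + 1}" "?x \<in> {1..2 * n + 1}"
    using i permutes_in_image[OF pp, of i] permutes_in_image[OF pp, of "Suc i"] by auto
  have ne: "p i \<noteq> ?x" by (simp add: inj_eq[OF permutes_inj[OF pp]])
  have ideals: "zigzag_ideal ?S" "zigzag_ideal (p ` {1..i - 1})"
    using Alt_inv_prefix_ideal[OF p] i by auto
  have S: "?S = insert (p i) (p ` {1..i - 1})"
    using i by (cases i) (auto simp: atLeastAtMostSuc_conv)
  have notin: "?x \<notin> ?S" "p i \<notin> p ` {1..i - 1}"
    using permutes_Suc_notin_image[OF pp, of i] permutes_Suc_notin_image[OF pp, of "i - 1"] i by auto
  have up: "\<not> (even (p i) \<and> ?x = p i + 1)"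
    using ideals(1) notin(1) i by (auto simp: zigzag_ideal_def)
  have down: "?x + 2 \<notin> ?S" if "even ?x" "p i = ?x + 1"
  proof
    assume "?x + 2 \<in> ?S"
    with S that have "?x + 2 \<in> p ` {1..i - 1}" by auto
    with ideals(2) that(1) have "?x + 2 - 1 \<in> p ` {1..i - 1}"
      unfolding zigzag_ideal_def by (metis even_add even_numeral)
    with that(2) notin(2) show False by simp
  qed
  have "kappa n a = (if even a then a + 1 else if a = 1 then 1 else a - 1)"
    if "a \<in> {1..2 * n + 1}" for a
    using that by (auto simp: kappa_def elim!: evenE)
  note kappa = this[OF in_m(1)] this[OF in_m(2)]
  have "step_order p (Suc i) (p i) ?x \<longleftrightarrow> p i < ?x \<or> (p i = ?x + 1 \<and> even ?x)"
    unfolding step_order_eq adapted_order_iff using down by blast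
  moreover have "1 \<le> p i" "1 \<le> ?x" using in_m by auto
  ultimately show ?thesis
    unfolding kappa using ne up by (auto split: if_splits; presburger)
qed

lemma maj_kappa:
  assumes p: "p \<in> Alt_inv (2 * n + 1)"
  shows "maj (word_of (2 * n + 1) (kappa n \<circ> p))
    = (\<Sum>i\<in>{1..<2 * n + 1}. if step_order p (Suc i) (p i) (p (Suc i)) then 0 else i)"
proof -
  have "descents (word_of (2 * n + 1) (kappa n \<circ> p))
      = {i \<in> {1..<2 * n + 1}. kappa n (p i) > kappa n (p (Suc i))}"
    by (auto simp: descents_def word_of_def letter_def simp del: upt_Suc)
  also have "\<dots> = {i \<in> {1..<2 * n + 1}. \<not> step_order p (Suc i) (p i) (p (Suc i))}"
    using kappa_descent_iff[OF p] by auto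
  finally have "maj (word_of (2 * n + 1) (kappa n \<circ> p))
      = \<Sum> {i \<in> {1..<2 * n + 1}. \<not> step_order p (Suc i) (p i) (p (Suc i))}"
    by (simp only: maj_def)
  also have "\<dots> = (\<Sum>i\<in>{1..<2 * n + 1}. if \<not> step_order p (Suc i) (p i) (p (Suc i)) then i else 0)"
    by (rule sum.inter_filter) simp
  also have "\<dots> = (\<Sum>i\<in>{1..<2 * n + 1}. if step_order p (Suc i) (p i) (p (Suc i)) then 0 else i)"
    by (rule sum.cong) auto
  finally show ?thesis .
qed

section \<open>Descents of the even part\<close>

lemma even_part_word_of: "even_part (word_of (2 * n + 1) q) = map (\<lambda>j. q (2 * j)) [1..<n + 1]"
proof -
  have "filter even [1..<2 * n + 2] = map (\<lambda>j. 2 * j) [1..<n + 1]"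
    by (induction n) auto
  then show ?thesis
    by (auto simp: even_part_def word_of_def letter_def simp del: upt_Suc)
qed

lemma ndes_even_part:
  "ndes (even_part (word_of (2 * n + 1) q))
    = n - card {j \<in> {1..<n}. q (2 * j) > q (2 * j + 2)}"
proof -
  have "descents (map (\<lambda>j. q (2 * j)) [1..<n + 1]) = {j \<in> {1..<n}. q (2 * j) > q (2 * j + 2)}"
    by (auto simp: descents_def letter_def simp del: upt_Suc)
  then show ?thesis
    unfolding ndes_def even_part_word_of by (simp del: upt_Suc)
qed

text \<open>
  The order is modified when a letter \<open>2j\<close> is placed before \<open>2j+2\<close>, or when \<open>j = n\<close>; so these steps
  correspond to the \<open>j\<close> in \<open>{1..n}\<close> at which the even part of \<open>\<pi>\<^sup>-\<^sup>1\<close> has no descent.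
\<close>

lemma card_swapped_steps:
  assumes p: "p \<in> Alt_inv (2 * n + 1)"
  shows "card {i \<in> {1..<2 * n + 1}. even (p (Suc i)) \<and> p (Suc i) + 2 \<notin> p ` {1..i}}
    = ndes (even_part (word_of (2 * n + 1) (inv p)))"
proof -
  let ?I = "{i \<in> {1..<2 * n + 1}. even (p (Suc i)) \<and> p (Suc i) + 2 \<notin> p ` {1..i}}"
  let ?D = "{j \<in> {1..<n}. inv p (2 * j) > inv p (2 * j + 2)}"
  have pp: "p permutes {1..2 * n + 1}" using p by (simp add: Alt_inv_def)
  have inj: "p i = p j \<longleftrightarrow> i = j" for i j by (simp add: inj_eq[OF permutes_inj[OF pp]])
  have earlier: "c \<in> p ` {1..i} \<longleftrightarrow> inv p c \<in> {1..i}" for c i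
    using inj by (metis image_iff permutes_inverses(1)[OF pp])
  have "bij_betw (\<lambda>j. inv p (2 * j) - 1) ({1..n} - ?D) ?I"
  (* Step i places the letter at position i + 1, hence the shift by one. *)
  proof (rule bij_betwI[where g = "\<lambda>i. p (Suc i) div 2"])
    have pos: "inv p (2 * j) \<in> {2..2 * n + 1}" if "j \<in> {1..n}" for j
    proof -
      have "inv p (2 * j) \<in> {1..2 * n + 1}"
        using that permutes_in_image[OF permutes_inv[OF pp], of "2 * j"] by auto
      moreover have "inv p (2 * j) \<noteq> 1"
      proof
        assume "inv p (2 * j) = 1"
        then have "2 * j \<in> p ` {1..1}" by (subst earlier) simp
        moreover have "zigzag_ideal (p ` {1..1})" using Alt_inv_prefix_ideal[OF p, of 1] by simp
        ultimately have "2 * j + 1 \<in> p ` {1..1}"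
          unfolding zigzag_ideal_def by (metis dvd_triv_left)
        with \<open>2 * j \<in> p ` {1..1}\<close> show False by simp
      qed
      ultimately show ?thesis by auto
    qed
    have Suc_pos: "Suc (inv p (2 * j) - 1) = inv p (2 * j)" if "j \<in> {1..n}" for j
      using pos[OF that] by auto
    show "(\<lambda>j. inv p (2 * j) - 1) \<in> ({1..n} - ?D) \<rightarrow> ?I"
    proof
      fix j assume j: "j \<in> {1..n} - ?D"
      then have j1: "j \<in> {1..n}" by auto
      have "\<not> inv p (2 * j + 2) \<in> {1..inv p (2 * j) - 1}"
      proof (cases "j = n")
        case True
        then have "inv p (2 * j + 2) = 2 * j + 2"
          using permutes_not_in[OF permutes_inv[OF pp]] by auto
        with pos[OF j1] True show ?thesis by auto
      next
        case False
        with j pos[OF j1] show ?thesis by auto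
      qed
      with pos[OF j1] show "inv p (2 * j) - 1 \<in> ?I"
        unfolding mem_Collect_eq Suc_pos[OF j1] earlier permutes_inverses(1)[OF pp] by auto
    qed
    have half: "2 * (p (Suc i) div 2) = p (Suc i)" "p (Suc i) div 2 \<in> {1..n}" if "i \<in> ?I" for i
    proof -
      have "p (Suc i) \<in> {1..2 * n + 1}"
        using that by (subst permutes_in_image[OF pp]) auto
      moreover show e: "2 * (p (Suc i) div 2) = p (Suc i)" using that by auto
      ultimately show "p (Suc i) div 2 \<in> {1..n}" by auto
    qed
    show "(\<lambda>i. p (Suc i) div 2) \<in> ?I \<rightarrow> {1..n} - ?D"
    proof
      fix i assume i: "i \<in> ?I"
      then have "\<not> inv p (p (Suc i) + 2) \<in> {1..i}" unfolding earlier[symmetric] by simp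
      moreover have "inv p (2 * (p (Suc i) div 2)) = Suc i"
        unfolding half(1)[OF i] by (rule permutes_inverses(2)[OF pp])
      moreover have "inv p (p (Suc i) + 2) \<noteq> 0"
        using permutes_in_image[OF permutes_inv[OF pp], of "p (Suc i) + 2"]
          permutes_not_in[OF permutes_inv[OF pp], of "p (Suc i) + 2"] by fastforce
      ultimately show "p (Suc i) div 2 \<in> {1..n} - ?D"
        using half[OF i] by auto
    qed
    show "p (Suc (inv p (2 * j) - 1)) div 2 = j" if "j \<in> {1..n} - ?D" for j
      using that Suc_pos[of j] by (simp add: permutes_inverses(1)[OF pp])
    show "inv p (2 * (p (Suc i) div 2)) - 1 = i" if "i \<in> ?I" for i
      unfolding half(1)[OF that] by (simp add: permutes_inverses(2)[OF pp])
  qed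
  then have "card ?I = card ({1..n} - ?D)" by (rule bij_betw_same_card[symmetric])
  also have "\<dots> = n - card ?D" by (subst card_Diff_subset) auto
  finally show ?thesis by (simp only: ndes_even_part)
qed

section \<open>The map on alternating permutations\<close>

lemma perm_of_permutes:
  assumes "distinct w" "set w = {1..length w}"
  shows "perm_of w permutes {1..length w}"
proof (rule bij_imp_permutes)
  have "perm_of w ` {1..length w} = set w"
  proof (intro equalityI subsetI)
    fix a assume "a \<in> set w"
    then obtain i where "i < length w" "a = w ! i" by (metis in_set_conv_nth)
    then have "a = perm_of w (Suc i)" "Suc i \<in> {1..length w}"
      by (auto simp: perm_of_def letter_def)
    then show "a \<in> perm_of w ` {1..length w}" by blast
  qed (auto simp: perm_of_def letter_def)
  moreover from this have "inj_on (perm_of w) {1..length w}"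
    using assms by (intro eq_card_imp_inj_on) auto
  ultimately show "bij_betw (perm_of w) {1..length w} {1..length w}"
    using assms(2) by (simp add: bij_betw_def)
qed (auto simp: perm_of_def)

lemma word_of_perm_of: "word_of (length w) (perm_of w) = w"
  by (intro nth_equalityI) (auto simp: word_of_def perm_of_def letter_def simp del: upt_Suc)

lemma word_of_F_alt:
  assumes "p permutes {1..2 * n + 1}"
  shows "word_of (2 * n + 1) (F_alt n p) = alt_word p (2 * n + 1)"
    "F_alt n p permutes {1..2 * n + 1}"
proof -
  note w = alt_word_set[OF assms, of "2 * n + 1"]
  show "word_of (2 * n + 1) (F_alt n p) = alt_word p (2 * n + 1)"
    using word_of_perm_of[of "alt_word p (2 * n + 1)"] w by (simp add: F_alt_def)
  show "F_alt n p permutes {1..2 * n + 1}"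
    using perm_of_permutes[of "alt_word p (2 * n + 1)"] w permutes_image[OF assms]
    by (simp add: F_alt_def)
qed

lemma F_alt_precedes:
  assumes p: "p \<in> Alt_inv (2 * n + 1)" and ab: "linked a b"
  shows "precedes (word_of (2 * n + 1) (F_alt n p)) a b \<longleftrightarrow> precedes (word_of (2 * n + 1) p) a b"
proof -
  have pp: "p permutes {1..2 * n + 1}" using p by (simp add: Alt_inv_def)
  show ?thesis
    using alt_word_precedes[OF p ab, of "2 * n + 1"]
    unfolding word_of_F_alt(1)[OF pp] unfolding word_of_def by simp
qed

lemma F_alt_in_Alt_inv:
  assumes p: "p \<in> Alt_inv (2 * n + 1)"
  shows "F_alt n p \<in> Alt_inv (2 * n + 1)"
  unfolding Alt_inv_iff
proof (intro conjI ballI)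
  show "F_alt n p permutes {1..2 * n + 1}"
    using p by (intro word_of_F_alt(2)) (simp add: Alt_inv_def)
  fix i assume "i \<in> {1..<2 * n + 1}"
  then have "if odd i then precedes (word_of (2 * n + 1) p) i (i + 1)
      else precedes (word_of (2 * n + 1) p) (i + 1) i"
    using p unfolding Alt_inv_iff by blast
  moreover have "if odd i then linked i (i + 1) else linked (i + 1) i"
    by (simp add: linked_def)
  ultimately show "if odd i then precedes (word_of (2 * n + 1) (F_alt n p)) i (i + 1)
      else precedes (word_of (2 * n + 1) (F_alt n p)) (i + 1) i"
    using F_alt_precedes[OF p] by presburger
qed

lemma ndes_F_alt:
  assumes p: "p \<in> Alt_inv (2 * n + 1)"
  shows "ndes (even_part (word_of (2 * n + 1) (inv (F_alt n p))))
    = ndes (even_part (word_of (2 * n + 1) (inv p)))"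
proof -
  have pp: "p permutes {1..2 * n + 1}" using p by (simp add: Alt_inv_def)
  have "inv (F_alt n p) (2 * j + 2) < inv (F_alt n p) (2 * j) \<longleftrightarrow> inv p (2 * j + 2) < inv p (2 * j)"
    if "j \<in> {1..<n}" for j
  proof -
    have j: "2 * j + 2 \<in> {1..2 * n + 1}" "2 * j \<in> {1..2 * n + 1}" using that by auto
    have "linked (2 * j + 2) (2 * j)" by (simp add: linked_def)
    from F_alt_precedes[OF p this] show ?thesis
      unfolding precedes_word_of_iff[OF pp j] precedes_word_of_iff[OF word_of_F_alt(2)[OF pp] j] .
  qed
  then have "{j \<in> {1..<n}. inv (F_alt n p) (2 * j) > inv (F_alt n p) (2 * j + 2)}
      = {j \<in> {1..<n}. inv p (2 * j) > inv p (2 * j + 2)}"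
    by blast
  then show ?thesis
    by (simp only: ndes_even_part)
qed

text \<open>
  The side used is not given, but the first letter of \<open>v\<close> lies on it, and it cannot lie on both sides.
\<close>

lemma side_rotates_unique:
  assumes "rotates (side prec l x) u v" "rotates (side prec l' x) u' v"
    "\<And>a. a \<in> set v \<Longrightarrow> prec x a \<longleftrightarrow> \<not> prec a x"
  shows "u = u'"
proof (cases "v = []")
  case True
  with rotates_mset[OF assms(1)] rotates_mset[OF assms(2)] show ?thesis by simp
next
  case False
  with rotates_hd[OF assms(1)] rotates_hd[OF assms(2)] assms(3)[of "hd v"]
  have "side prec l x = side prec l' x"
    by (auto simp: side_def split: if_splits)
  with assms show ?thesis by (metis rotates_right_unique)
qed

text \<open>
  Undoing one step needs the letter placed, which is the last one, and the order used, which depends on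
  this letter and the set of the other letters. Both can be read off from the common word.
\<close>

lemma alt_word_unique:
  assumes p: "p permutes {1..m}" "q permutes {1..m}" and k: "1 \<le> k" "k \<le> m"
    and eq: "alt_word p k = alt_word q k"
  shows "\<forall>i\<in>{1..k}. p i = q i"
  using k eq
proof (induction k rule: dec_induct)
  case base
  then show ?case by simp
next
  case (step k)
  have k: "1 \<le> k" "k < m" using step by auto
  obtain v where v: "alt_word p (Suc k) = v @ [p (Suc k)]"
    "rotates (side (step_order p (Suc k)) (p k) (p (Suc k))) (alt_word p k) v"
    using alt_word_step[OF p(1) k] .
  obtain v' where v': "alt_word q (Suc k) = v' @ [q (Suc k)]"
    "rotates (side (step_order q (Suc k)) (q k) (q (Suc k))) (alt_word q k) v'"
    using alt_word_step[OF p(2) k] .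
  have eqs: "v' = v" "q (Suc k) = p (Suc k)" using v(1) v'(1) step.prems by auto
  have S: "p ` {1..k} = set v" "q ` {1..k} = set v"
    using mset_eq_setD[OF rotates_mset[OF v(2)]] mset_eq_setD[OF rotates_mset[OF v'(2)]]
      alt_word_set(1)[OF p(1)] alt_word_set(1)[OF p(2)] k eqs(1) by auto
  have "p (Suc k) \<notin> set v"
    unfolding S(1)[symmetric] by (rule permutes_Suc_notin_image[OF p(1)])
  then have "adapted_order (set v) (p (Suc k)) (p (Suc k)) a
      \<longleftrightarrow> \<not> adapted_order (set v) (p (Suc k)) a (p (Suc k))" if "a \<in> set v" for a
    using that by (metis adapted_order_total)
  with v(2) v'(2) have "alt_word p k = alt_word q k"
    unfolding step_order_eq eqs S by (rule side_rotates_unique)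
  then have "\<forall>i\<in>{1..k}. p i = q i" using step by simp
  with eqs(2) show ?case by (auto simp: le_Suc_eq)
qed

lemma F_alt_inj: "inj_on (F_alt n) {p. p permutes {1..2 * n + 1}}"
proof (rule inj_onI)
  fix p q assume "p \<in> {p. p permutes {1..2 * n + 1}}" "q \<in> {p. p permutes {1..2 * n + 1}}"
    and eq: "F_alt n p = F_alt n q"
  then have p: "p permutes {1..2 * n + 1}" "q permutes {1..2 * n + 1}" by auto
  have "alt_word p (2 * n + 1) = alt_word q (2 * n + 1)"
    using word_of_F_alt(1)[OF p(1)] word_of_F_alt(1)[OF p(2)] eq by simp
  then have "\<forall>i\<in>{1..2 * n + 1}. p i = q i"
    using alt_word_unique[OF p, of "2 * n + 1"] by simp
  then show "p = q"
    using permutes_not_in[OF p(1)] permutes_not_in[OF p(2)] by (metis ext)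
qed

theorem theorem4p6:
  fixes n :: nat
  assumes "n \<ge> 1"
  shows "bij_betw (F_alt n) (Alt_inv (2 * n + 1)) (Alt_inv (2 * n + 1)) \<and>
    (\<forall>p \<in> Alt_inv (2 * n + 1). \<forall>\<sigma>. \<sigma> = F_alt n p \<longrightarrow>
       int (maj (word_of (2 * n + 1) (kappa n \<circ> p))) =
       int (inversions (word_of (2 * n + 1) \<sigma>))
         - int (ndes (even_part (word_of (2 * n + 1) (inv \<sigma>)))))"
proof (intro conjI ballI allI impI)
  let ?A = "Alt_inv (2 * n + 1)"
  have sub: "?A \<subseteq> {p. p permutes {1..2 * n + 1}}" by (auto simp: Alt_inv_def)
  have "finite ?A" using sub finite_permutations[of "{1..2 * n + 1}"] by (auto intro: finite_subset)
  moreover have "F_alt n ` ?A \<subseteq> ?A" using F_alt_in_Alt_inv by auto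
  moreover have "inj_on (F_alt n) ?A" using F_alt_inj sub by (rule inj_on_subset)
  ultimately show "bij_betw (F_alt n) ?A ?A"
    by (simp add: bij_betw_def endo_inj_surj)
next
  fix p \<sigma> assume p: "p \<in> Alt_inv (2 * n + 1)" and \<sigma>: "\<sigma> = F_alt n p"
  then have "p permutes {1..2 * n + 1}" by (simp add: Alt_inv_def)
  then have "inversions (word_of (2 * n + 1) \<sigma>) = inv_count (alt_word p (2 * n + 1))"
    unfolding \<sigma> inversions_eq_inv_count by (simp only: word_of_F_alt(1))
  also have "\<dots> = maj (word_of (2 * n + 1) (kappa n \<circ> p))
      + ndes (even_part (word_of (2 * n + 1) (inv \<sigma>)))"
    using alt_word_inv_count[OF p, of "2 * n + 1"] \<sigma>
    by (simp only: maj_kappa[OF p] card_swapped_steps[OF p] ndes_F_alt[OF p])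
  finally show "int (maj (word_of (2 * n + 1) (kappa n \<circ> p))) =
      int (inversions (word_of (2 * n + 1) \<sigma>))
        - int (ndes (even_part (word_of (2 * n + 1) (inv \<sigma>))))"
    by simp
qed

end
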